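(* Let $0<\alpha\le 1$, let $m$ be a natural number, and for each integer $n\ge 0$ let $L_n^m(\tfrac{x^\alpha}{\alpha})$ be the conformable associated Laguerre polynomial. Then for all $x\ge 0$ and all real $t$ with $|t|<1$, $$\frac{e^{-\frac{x^\alpha t}{\alpha(1-t)}}}{(1-t)^{m+1}}=\sum_{n=0}^\infty L_n^m\!\left(\frac{x^\alpha}{\alpha}\right)t^n.$$
   Context: For $0<\alpha\le 1$, the conformable derivative of order $\alpha$ of a function $f$ at $x>0$ is $D^\alpha f(x)=\lim_{\epsilon\to 0}\frac{f(x+\epsilon x^{1-\alpha})-f(x)}{\epsilon}$, and at $x=0$ it is defined by $D^\alpha f(0)=\lim_{x\to 0^+}D^\alpha f(x)$ when the limit exists. $D^{m\alpha}$ denotes the $m$-fold composition $D^\alpha\circ\cdots\circ D^\alpha$ (with $D^0$ the identity), acting in the variable $x$. For an integer $N\ge 0$, the conformable Laguerre polynomial of order $N$ is $$L_N\!\left(\frac{x^\alpha}{\alpha}\right)=\sum_{k=0}^N (-1)^k \frac{N!}{\alpha^k\,(N-k)!\,(k!)^2}\,x^{k\alpha},$$ with $x^0=1$ also at $x=0$, and the conformable associated Laguerre polynomial is defined by $$L_n^m\!\left(\frac{x^\alpha}{\alpha}\right)=(-1)^m D^{m\alpha}L_{n+m}\!\left(\frac{x^\alpha}{\alpha}\right).$$ *)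

theory Defs
  imports Complex_Main
begin

text \<open>Only arguments \<open>x \<ge> 0\<close> are meaningful here; the values at \<open>x < 0\<close> are irrelevant,
  since the limits at \<open>x > 0\<close> and the one-sided limit at \<open>0\<close> never see them.\<close>

definition conformable_deriv_at :: "real \<Rightarrow> (real \<Rightarrow> real) \<Rightarrow> real \<Rightarrow> real" where
  "conformable_deriv_at \<alpha> f x =
     Lim (at 0) (\<lambda>\<epsilon>. (f (x + \<epsilon> * x powr (1 - \<alpha>)) - f x) / \<epsilon>)"

definition conformable_deriv :: "real \<Rightarrow> (real \<Rightarrow> real) \<Rightarrow> real \<Rightarrow> real" where
  "conformable_deriv \<alpha> f x =
     (if x = 0 then Lim (at_right 0) (conformable_deriv_at \<alpha> f)
      else conformable_deriv_at \<alpha> f x)"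

text \<open>The function \<open>x \<mapsto> L\<^sub>N (x\<^sup>\<alpha> / \<alpha>)\<close>. The power \<open>x\<close> to the \<open>k \<alpha>\<close> is written \<open>(x powr \<alpha>) ^ k\<close>, which is
  \<open>1\<close> for \<open>k = 0\<close> also at \<open>x = 0\<close>, whereas \<open>0 powr 0 = 0\<close>.\<close>

definition conformable_laguerre :: "real \<Rightarrow> nat \<Rightarrow> real \<Rightarrow> real" where
  "conformable_laguerre \<alpha> N x =
     (\<Sum>k=0..N. (-1) ^ k * (fact N / (\<alpha> ^ k * fact (N - k) * (fact k)\<^sup>2)) * (x powr \<alpha>) ^ k)"

definition conformable_assoc_laguerre :: "real \<Rightarrow> nat \<Rightarrow> nat \<Rightarrow> real \<Rightarrow> real" where
  "conformable_assoc_laguerre \<alpha> m n x =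
     (-1) ^ m * ((conformable_deriv \<alpha> ^^ m) (conformable_laguerre \<alpha> (n + m))) x"

end

theory Submission
  imports Defs "HOL-Analysis.Analysis" "HOL-Computational_Algebra.Polynomial"
begin

text \<open>In the variable \<open>u = x\<^sup>\<alpha> / \<alpha>\<close> the conformable derivative is ordinary differentiation, so
  \<open>L\<^sub>n\<^sup>m\<close> is up to sign the \<open>m\<close>-th derivative of the classical polynomial \<open>L\<^sub>n\<^sub>+\<^sub>m\<close>, that is,
  the sum of \<open>(n+m choose k+m) (-u)\<^sup>k / k!\<close> over \<open>k \<le> n\<close>.
  In the resulting absolutely convergent double series, summing over \<open>n\<close> first gives the
  negative binomial series \<open>1 / (1-t)\<^bsup>k+m+1\<^esup>\<close>, and what remains is the exponential
  series in \<open>-ut / (1-t)\<close>.\<close>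

text \<open>The quotient is the ordinary difference quotient at \<open>0\<close> of \<open>f\<close>
  along the line \<open>x + \<epsilon> * x powr (1 - \<alpha>)\<close>, so the chain rule
  contributes the slope of that line as a factor.\<close>

lemma conformable_deriv_at_DERIV:
  assumes "x > 0" and "(f has_real_derivative d) (at x)"
  shows "conformable_deriv_at \<alpha> f x = x powr (1 - \<alpha>) * d"
proof -
  let ?c = "x powr (1 - \<alpha>)"
  have "((\<lambda>\<epsilon>. f (x + \<epsilon> * ?c)) has_real_derivative d * ?c) (at 0)"
    by (rule DERIV_chain2[where f = f]) (use assms in \<open>auto intro!: derivative_eq_intros\<close>)
  then have "((\<lambda>\<epsilon>. (f (x + \<epsilon> * ?c) - f x) / \<epsilon>) \<longlongrightarrow> d * ?c) (at 0)"
    by (simp add: DERIV_def)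
  then show ?thesis
    unfolding conformable_deriv_at_def by (subst tendsto_Lim) (auto simp: mult.commute)
qed

text \<open>The inner derivative \<open>x powr (\<alpha> - 1)\<close> from the chain rule cancels
  the factor \<open>x powr (1 - \<alpha>)\<close>. Agreement of \<open>f\<close> with the polynomial
  expression on the open half-line is enough, since differentiation at \<open>x > 0\<close> is
  local.\<close>

lemma conformable_deriv_at_poly_powr:
  assumes "\<alpha> \<noteq> 0" and "x > 0" and f: "\<And>y. y > 0 \<Longrightarrow> f y = poly p (y powr \<alpha> / \<alpha>)"
  shows "conformable_deriv_at \<alpha> f x = poly (pderiv p) (x powr \<alpha> / \<alpha>)"
proof -
  have "((\<lambda>y. y powr \<alpha> / \<alpha>) has_real_derivative x powr (\<alpha> - 1)) (at x)"
    using DERIV_cdivide[OF has_real_derivative_powr[OF \<open>x > 0\<close>, of \<alpha>], of \<alpha>] \<open>\<alpha> \<noteq> 0\<close> by simp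
  then have "((\<lambda>y. poly p (y powr \<alpha> / \<alpha>)) has_real_derivative
      poly (pderiv p) (x powr \<alpha> / \<alpha>) * x powr (\<alpha> - 1)) (at x)"
    by (rule DERIV_chain2[OF poly_DERIV])
  then have "(f has_real_derivative poly (pderiv p) (x powr \<alpha> / \<alpha>) * x powr (\<alpha> - 1)) (at x)"
    by (rule has_field_derivative_transform_within_open[where S = "{0<..}"])
       (use assms in auto)
  from conformable_deriv_at_DERIV[OF \<open>x > 0\<close> this, of \<alpha>] \<open>x > 0\<close> show ?thesis
    by (simp add: powr_add[symmetric] mult.left_commute)
qed

text \<open>At \<open>0\<close> the value is a limit of the values on the right;
  \<open>y powr \<alpha>\<close> tends to \<open>0\<close> because \<open>\<alpha> > 0\<close>, and
  polynomials are continuous. The formula thus holds on all of \<open>x \<ge> 0\<close>, so it can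
  be iterated.\<close>

lemma conformable_deriv_poly_powr:
  assumes "\<alpha> > 0" and "x \<ge> 0" and f: "\<And>y. y \<ge> 0 \<Longrightarrow> f y = poly p (y powr \<alpha> / \<alpha>)"
  shows "conformable_deriv \<alpha> f x = poly (pderiv p) (x powr \<alpha> / \<alpha>)"
proof (cases "x = 0")
  case True
  have "((\<lambda>y::real. y powr \<alpha>) \<longlongrightarrow> 0) (at_right 0)"
    by (rule tendsto_eq_intros tendsto_zero_powrI)+
       (use \<open>\<alpha> > 0\<close> in \<open>auto simp: eventually_at_filter\<close>)
  then have "((\<lambda>y. y powr \<alpha> / \<alpha>) \<longlongrightarrow> 0) (at_right 0)"
    using tendsto_divide_zero by blast
  then have "((\<lambda>y. poly (pderiv p) (y powr \<alpha> / \<alpha>)) \<longlongrightarrow> poly (pderiv p) 0) (at_right 0)"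
    by (intro tendsto_intros)
  moreover have "\<forall>\<^sub>F y in at_right 0.
      poly (pderiv p) (y powr \<alpha> / \<alpha>) = conformable_deriv_at \<alpha> f y"
    using conformable_deriv_at_poly_powr[of \<alpha> _ f p] assms
    by (auto simp: eventually_at_filter)
  ultimately have "(conformable_deriv_at \<alpha> f \<longlongrightarrow> poly (pderiv p) 0) (at_right 0)"
    by (rule Lim_transform_eventually)
  with True show ?thesis
    by (simp add: conformable_deriv_def tendsto_Lim)
next
  case False
  then show ?thesis
    using conformable_deriv_at_poly_powr[of \<alpha> x f p] assms
    by (simp add: conformable_deriv_def)
qed

lemma conformable_deriv_funpow_poly_powr:
  assumes "\<alpha> > 0" and "x \<ge> 0" and "\<And>y. y \<ge> 0 \<Longrightarrow> f y = poly p (y powr \<alpha> / \<alpha>)"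
  shows "(conformable_deriv \<alpha> ^^ m) f x = poly ((pderiv ^^ m) p) (x powr \<alpha> / \<alpha>)"
  using assms(2)
proof (induction m arbitrary: x)
  case 0
  then show ?case using assms(3) by simp
next
  case (Suc m)
  then show ?case
    using conformable_deriv_poly_powr[OF \<open>\<alpha> > 0\<close> Suc.prems Suc.IH] by simp
qed

text \<open>The classical Laguerre polynomial in \<open>u\<close>. Substituting
  \<open>u = x powr \<alpha> / \<alpha>\<close> accounts for the powers of \<open>\<alpha>\<close>
  in \<open>conformable_laguerre\<close>.\<close>

definition laguerre_poly :: "nat \<Rightarrow> real poly" where
  "laguerre_poly N = (\<Sum>k\<le>N. monom ((-1) ^ k * real (N choose k) / fact k) k)"

lemma coeff_laguerre_poly:
  "coeff (laguerre_poly N) k = (-1) ^ k * real (N choose k) / fact k"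
  by (cases "k \<le> N") (simp_all add: laguerre_poly_def coeff_sum)

lemma degree_laguerre_poly_le: "degree (laguerre_poly N) \<le> N"
  by (rule degree_le) (simp add: coeff_laguerre_poly)

lemma conformable_laguerre_eq_poly:
  assumes "\<alpha> \<noteq> 0"
  shows "conformable_laguerre \<alpha> N x = poly (laguerre_poly N) (x powr \<alpha> / \<alpha>)"
  unfolding conformable_laguerre_def laguerre_poly_def poly_sum atLeast0AtMost
proof (rule sum.cong[OF refl])
  fix k assume "k \<in> {..N}"
  then show "(-1) ^ k * (fact N / (\<alpha> ^ k * fact (N - k) * (fact k)\<^sup>2)) * (x powr \<alpha>) ^ k =
      poly (monom ((-1) ^ k * real (N choose k) / fact k) k) (x powr \<alpha> / \<alpha>)"
    using assms by (simp add: poly_monom binomial_fact power_divide power2_eq_square field_simps)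
qed

text \<open>Differentiating \<open>m\<close> times shifts the coefficients by \<open>m\<close> and
  multiplies them by \<open>(k + 1) ... (k + m) = (k + m)! / k!\<close>, which turns
  \<open>1 / (k + m)!\<close> into \<open>1 / k!\<close>. The sign \<open>(-1) ^ m\<close> of the
  shift cancels the one in the definition.\<close>

lemma conformable_assoc_laguerre_eq_sum:
  assumes "\<alpha> > 0" and "x \<ge> 0"
  shows "conformable_assoc_laguerre \<alpha> m n x =
    (\<Sum>k\<le>n. real (n + m choose (k + m)) * (- (x powr \<alpha> / \<alpha>)) ^ k / fact k)"
proof -
  let ?u = "x powr \<alpha> / \<alpha>"
  let ?q = "(pderiv ^^ m) (laguerre_poly (n + m))"
  have coeff: "(-1) ^ m * coeff ?q k = (-1) ^ k * real (n + m choose (k + m)) / fact k" for k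
  proof -
    have "fact (k + m) = fact k * (pochhammer (1 + real k) m)"
      by (simp add: pochhammer_fact pochhammer_product')
    then have "pochhammer (1 + real k) m / fact (k + m) = 1 / fact k"
      using fact_nonzero[of "k + m", where 'a = real] by auto
    moreover have "(-1) ^ m * coeff ?q k =
        ((-1) ^ m * (-1) ^ m) * (-1) ^ k * real (n + m choose (k + m)) *
        (pochhammer (1 + real k) m / fact (k + m))"
      by (simp add: coeff_higher_pderiv coeff_laguerre_poly power_add)
    ultimately show ?thesis
      by (simp flip: power_mult_distrib)
  qed
  \<comment> \<open>\<open>poly_altdef\<close> sums only up to the actual degree; the bound allows
    padding with zero coefficients up to \<open>n\<close>.\<close>
  have "degree ?q \<le> n"
    using degree_laguerre_poly_le[of "n + m"] by (simp add: degree_higher_pderiv)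
  then have poly: "poly ?q ?u = (\<Sum>k\<le>n. coeff ?q k * ?u ^ k)"
    unfolding poly_altdef
    by (intro sum.mono_neutral_left) (auto simp: not_le coeff_eq_0)
  have "conformable_assoc_laguerre \<alpha> m n x = (-1) ^ m * poly ?q ?u"
    unfolding conformable_assoc_laguerre_def
    using conformable_deriv_funpow_poly_powr[OF assms conformable_laguerre_eq_poly] assms
    by simp
  also have "\<dots> = (\<Sum>k\<le>n. ((-1) ^ m * coeff ?q k) * ?u ^ k)"
    by (simp add: poly sum_distrib_left mult.assoc)
  also have "\<dots> = (\<Sum>k\<le>n. real (n + m choose (k + m)) * (- ?u) ^ k / fact k)"
    unfolding coeff by (intro sum.cong refl, subst power_minus) simp
  finally show ?thesis .
qed

text \<open>This is the binomial series with exponent \<open>- (r + 1)\<close> at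
  \<open>- t\<close>; the sign from negating the upper index cancels that of
  \<open>(- t) ^ j\<close>.\<close>

lemma negative_binomial_sums:
  fixes t :: real
  assumes "\<bar>t\<bar> < 1"
  shows "(\<lambda>j. real (j + r choose r) * t ^ j) sums (1 / (1 - t) ^ (r + 1))"
proof -
  have "(\<lambda>j. (- real (r + 1) gchoose j) * (- t) ^ j) sums (1 + - t) powr (- real (r + 1))"
    by (rule gen_binomial_real) (use assms in simp)
  moreover have "(- real (r + 1) gchoose j) * (- t) ^ j = real (j + r choose r) * t ^ j" for j
  proof -
    \<comment> \<open>The new upper index is \<open>(r + 1) + j - 1 = j + r\<close>.\<close>
    have "(- real (r + 1) gchoose j) = (-1) ^ j * (real (j + r) gchoose j)"
      by (subst gbinomial_minus) (simp add: add.commute)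
    also have "real (j + r) gchoose j = real (j + r choose r)"
      using binomial_symmetric[of r "j + r"] by (simp add: binomial_gbinomial)
    finally show ?thesis
      by (subst power_minus) (simp flip: power_mult_distrib)
  qed
  moreover have "(1 + - t) powr (- real (r + 1)) = 1 / (1 - t) ^ (r + 1)"
    unfolding powr_minus_divide using assms powr_realpow[of "1 - t" "r + 1"] by simp
  ultimately show ?thesis by simp
qed

text \<open>Once \<open>1 / (1 - t) ^ (m + 1)\<close> is factored out, the exponential series in
  \<open>u * t / (1 - t)\<close> remains.\<close>

lemma exp_series_sums:
  fixes u t :: real
  assumes "t \<noteq> 1"
  shows "(\<lambda>k. (u * t) ^ k / fact k * (1 / (1 - t) ^ (k + m + 1))) sums
    (exp (u * t / (1 - t)) / (1 - t) ^ (m + 1))"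
proof -
  have "(\<lambda>k. (u * t / (1 - t)) ^ k / fact k / (1 - t) ^ (m + 1)) sums
      (exp (u * t / (1 - t)) / (1 - t) ^ (m + 1))"
    using exp_converges[of "u * t / (1 - t)"]
    by (intro sums_divide) (simp add: divide_inverse mult.commute)
  then show ?thesis
    by (simp add: power_divide power_add field_simps)
qed

text \<open>Here \<open>u\<close> stands for \<open>- (x powr \<alpha> / \<alpha>)\<close>, which
  absorbs the alternating sign.\<close>

lemma assoc_laguerre_generating_function:
  fixes u t :: real
  assumes "\<bar>t\<bar> < 1"
  shows "(\<lambda>n. (\<Sum>k\<le>n. real (n + m choose (k + m)) * u ^ k / fact k) * t ^ n) sums
    (exp (u * t / (1 - t)) / (1 - t) ^ (m + 1))"
proof -
  \<comment> \<open>\<open>F\<close> is the term of the double series with \<open>n = k + j\<close>,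
    and \<open>G\<close> is its sum over \<open>j\<close>. Both keep \<open>u\<close> and
    \<open>t\<close> as parameters so that \<open>F \<bar>u\<bar> \<bar>t\<bar>\<close> can serve as
    the series of absolute values.\<close>
  define F where
    "F u t = (\<lambda>(k, j). (u * t) ^ k / fact k * (real (j + (k + m) choose (k + m)) * t ^ j))"
    for u t :: real
  define G where "G u t k = (u * t) ^ k / fact k * (1 / (1 - t) ^ (k + m + 1))"
    for u t :: real and k
  have F_sums: "(\<lambda>j. F u t (k, j)) sums G u t k" if "\<bar>t\<bar> < 1" for u t k
    unfolding F_def G_def prod.case
    by (intro sums_mult negative_binomial_sums that)
  have abs_F: "\<bar>F u t p\<bar> = F \<bar>u\<bar> \<bar>t\<bar> p" for p
    by (cases p) (simp add: F_def abs_mult power_abs)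
  have F_nonneg: "F \<bar>u\<bar> \<bar>t\<bar> p \<ge> 0" for p
    by (cases p) (simp add: F_def)
  have t: "t \<noteq> 1" "\<bar>t\<bar> \<noteq> 1" "\<bar>\<bar>t\<bar>\<bar> < 1" using assms by auto
  have summable_G: "summable (\<lambda>k. G \<bar>u\<bar> \<bar>t\<bar> k)"
    unfolding G_def using exp_series_sums[OF t(2)] by (rule sums_summable)
  have G_nonneg: "G \<bar>u\<bar> \<bar>t\<bar> k \<ge> 0" for k
    using assms by (simp add: G_def)
  \<comment> \<open>Tonelli: the terms are nonnegative, so convergent row sums with a convergent
    total suffice.\<close>
  have "F \<bar>u\<bar> \<bar>t\<bar> summable_on UNIV \<times> UNIV"
  proof (rule summable_on_SigmaI)
    show "((\<lambda>j. F \<bar>u\<bar> \<bar>t\<bar> (k, j)) has_sum G \<bar>u\<bar> \<bar>t\<bar> k) UNIV" for k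
      by (intro sums_nonneg_imp_has_sum F_sums F_nonneg t)
    show "G \<bar>u\<bar> \<bar>t\<bar> summable_on UNIV"
      by (intro summable_nonneg_imp_summable_on summable_G G_nonneg)
  qed (rule F_nonneg)
  then have summable: "F u t summable_on UNIV \<times> UNIV"
    using abs_summable_summable[of "F u t"] by (simp add: abs_F)
  have inner: "((\<lambda>j. F u t (k, j)) has_sum G u t k) UNIV" for k
    using F_sums[OF t(3), of "\<bar>u\<bar>" k]
    by (intro norm_summable_imp_has_sum F_sums assms) (simp add: abs_F sums_iff)
  have "G u t sums (exp (u * t / (1 - t)) / (1 - t) ^ (m + 1))"
    unfolding G_def by (rule exp_series_sums[OF t(1)])
  \<comment> \<open>Unconditional summability of the row sums lets the value of the ordered series
    \<open>sums\<close> be transferred to \<open>has_sum\<close>.\<close>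
  moreover have "G u t summable_on UNIV"
    using summable_on_Sigma_banach[of "\<lambda>k j. F u t (k, j)" UNIV "\<lambda>_. UNIV"] summable
      infsumI[OF inner] by simp
  ultimately have "(G u t has_sum (exp (u * t / (1 - t)) / (1 - t) ^ (m + 1))) UNIV"
    using has_sum_imp_sums has_sum_infsum sums_unique2 by metis
  with inner have "(F u t has_sum (exp (u * t / (1 - t)) / (1 - t) ^ (m + 1))) (UNIV \<times> UNIV)"
    by (intro has_sum_SigmaI summable)
  \<comment> \<open>Regrouping by the power of \<open>t\<close>: the pair \<open>(k, j)\<close>
    becomes \<open>(n, k)\<close> with \<open>n = k + j\<close>, so the quadrant turns into the
    triangle \<open>k \<le> n\<close> and each inner sum becomes finite.\<close>
  also have "?this \<longleftrightarrow>
      ((\<lambda>(n, k). real (n + m choose (k + m)) * u ^ k / fact k * t ^ n) has_sum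
        (exp (u * t / (1 - t)) / (1 - t) ^ (m + 1))) (SIGMA n:UNIV. {..n})"
    by (rule has_sum_reindex_bij_witness[where i = "\<lambda>(n, k). (k, n - k)"
          and j = "\<lambda>(k, j). (k + j, k)"])
       (auto simp: F_def power_add power_mult_distrib add_ac)
  finally have "((\<lambda>n. \<Sum>k\<le>n. real (n + m choose (k + m)) * u ^ k / fact k * t ^ n) has_sum
      (exp (u * t / (1 - t)) / (1 - t) ^ (m + 1))) UNIV"
    by (rule has_sum_SigmaD) (simp add: has_sum_finite)
  then show ?thesis
    by (intro has_sum_imp_sums) (simp add: sum_distrib_right)
qed

theorem mainTheorem8:
  fixes \<alpha> x t :: real and m :: nat
  assumes "0 < \<alpha>" and "\<alpha> \<le> 1" and "0 \<le> x" and "\<bar>t\<bar> < 1"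
  shows "(\<lambda>n. conformable_assoc_laguerre \<alpha> m n x * t ^ n) sums
           (exp (- (x powr \<alpha> * t) / (\<alpha> * (1 - t))) / (1 - t) ^ (m + 1))"
  using assoc_laguerre_generating_function[OF \<open>\<bar>t\<bar> < 1\<close>, of m "- (x powr \<alpha> / \<alpha>)"]
  by (simp add: conformable_assoc_laguerre_eq_sum[OF \<open>0 < \<alpha>\<close> \<open>0 \<le> x\<close>])

end
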